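(* The assignments $$L_0: \mathrm{Obj}(\mathbf{Set}) \to \mathrm{Obj}(\mathcal{C}^{\infty}\mathbf{Rng}),\quad X \mapsto (\mathcal{C}^{\infty}(\mathbb{R}^X), \Phi_X),$$ $$L_1: \mathrm{Mor}(\mathbf{Set}) \to \mathrm{Mor}(\mathcal{C}^{\infty}\mathbf{Rng}),\quad (X \xrightarrow{f} Y) \mapsto \big((\mathcal{C}^{\infty}(\mathbb{R}^X), \Phi_X) \xrightarrow{\widetilde{f}} (\mathcal{C}^{\infty}(\mathbb{R}^Y), \Phi_Y)\big),$$ where $\widetilde{f}: L_0(X) \to L_0(Y)$ is the unique $\mathcal{C}^{\infty}$-homomorphism, given by the universal property of the free $\mathcal{C}^{\infty}$-ring $\jmath_X: X \rightarrow \mathcal{C}^{\infty}(\mathbb{R}^{X})$, such that $U(\widetilde{f})\circ\jmath_X=\jmath_Y\circ f$, define a functor $L: \mathbf{Set} \rightarrow \mathcal{C}^{\infty}\mathbf{Rng}$ which is left adjoint to the forgetful functor $U: \mathcal{C}^{\infty}\mathbf{Rng} \to \mathbf{Set}$, $(A,\Phi)\mapsto A$.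
   Context: $\mathbb{N}=\{0,1,2,\dots\}$. A $\mathcal{C}^{\infty}$-structure is a pair $(A,\Phi)$, where $A$ is a set and $\Phi$ assigns to each $n\in\mathbb{N}$ and each smooth function $f\in\mathcal{C}^{\infty}(\mathbb{R}^n,\mathbb{R})$ a function $\Phi(f):A^n\to A$. It is a $\mathcal{C}^{\infty}$-ring if (1) for each $n$ and $k\le n$, the projection $p_k:\mathbb{R}^n\to\mathbb{R}$ onto the $k$-th coordinate is sent to the projection $\pi_k:A^n\to A$ onto the $k$-th coordinate; and (2) whenever $f\in\mathcal{C}^{\infty}(\mathbb{R}^n,\mathbb{R})$, $g_1,\dots,g_n,h\in\mathcal{C}^{\infty}(\mathbb{R}^k,\mathbb{R})$ and $h=f\circ(g_1,\dots,g_n)$, then $\Phi(h)=\Phi(f)\circ(\Phi(g_1),\dots,\Phi(g_n))$. A $\mathcal{C}^{\infty}$-homomorphism $\varphi:(A,\Phi)\to(B,\Psi)$ is a function $\varphi:A\to B$ with $\varphi(\Phi(f)(a_1,\dots,a_n))=\Psi(f)(\varphi(a_1),\dots,\varphi(a_n))$ for all $n$, all $f\in\mathcal{C}^{\infty}(\mathbb{R}^n,\mathbb{R})$ and all $a_i\in A$. $\mathcal{C}^{\infty}\mathbf{Rng}$ is the category of $\mathcal{C}^{\infty}$-rings and $\mathcal{C}^{\infty}$-homomorphisms. For a finite set $X=\{x_1,\dots,x_n\}$ (with $n$ elements), $\mathbb{R}^X$ is the set of functions $X\to\mathbb{R}$, and $\mathcal{C}^{\infty}(\mathbb{R}^X)$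 is the set of functions $\widehat g:\mathbb{R}^X\to\mathbb{R}$, $\widehat g(t)=g(t(x_1),\dots,t(x_n))$, with $g\in\mathcal{C}^{\infty}(\mathbb{R}^n,\mathbb{R})$; its $\mathcal{C}^{\infty}$-ring structure $\Phi_X$ is given by composition, $\Phi_X(f)(\widehat{g_1},\dots,\widehat{g_m})=f\circ(\widehat{g_1},\dots,\widehat{g_m})$; and $\jmath_X:X\to\mathcal{C}^{\infty}(\mathbb{R}^X)$ is $x\mapsto \mathrm{ev}_x$, $\mathrm{ev}_x(t)=t(x)$. For an arbitrary set $E$, $(\mathcal{C}^{\infty}(\mathbb{R}^E),\Phi_E)=\varinjlim_{E'\subseteq_f E}(\mathcal{C}^{\infty}(\mathbb{R}^{E'}),\Phi_{E'})$ is the directed colimit in $\mathcal{C}^{\infty}\mathbf{Rng}$ over the finite subsets $E'$ of $E$ ordered by inclusion, with transition maps $g\mapsto g\circ\mu$, where $\mu:\mathbb{R}^{E''}\to\mathbb{R}^{E'}$ is restriction ($E'\subseteq E''$), and with canonical maps $\ell_{E'}$ into the colimit; $\jmath_E:E\to\mathcal{C}^{\infty}(\mathbb{R}^E)$ is the unique map with $\jmath_E(x)=\ell_{E'}(\jmath_{E'}(x))$ for all finite $E'\subseteq E$ and $x\in E'$. Equivalently, $\mathcal{C}^{\infty}(\mathbb{R}^E)$ is the set of functions $\mathbb{R}^E\to\mathbb{R}$ that depend smoothly on finitely many variables only. The pair $(\jmath_E,(\mathcal{C}^{\infty}(\mathbb{R}^E),\Phi_E))$ is the free $\mathcal{C}^{\infty}$-ring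 on $E$: for every $\mathcal{C}^{\infty}$-ring $(A,\Phi)$ and every function $\alpha:E\to A$ there is a unique $\mathcal{C}^{\infty}$-homomorphism $\widetilde\alpha$ from it to $(A,\Phi)$ with $U(\widetilde\alpha)\circ\jmath_E=\alpha$. *)

theory Defs
  imports "HOL-Analysis.Analysis"
begin

section \<open>Smooth functions on real coordinate spaces\<close>

definition rpow :: "'i set \<Rightarrow> ('i \<Rightarrow> real) set" where
  "rpow I = I \<rightarrow>\<^sub>E UNIV"

definition tuples :: "nat \<Rightarrow> 'a set \<Rightarrow> (nat \<Rightarrow> 'a) set" where
  "tuples n A = {..<n} \<rightarrow>\<^sub>E A"

definition partial_deriv :: "nat \<Rightarrow> nat \<Rightarrow> ((nat \<Rightarrow> real) \<Rightarrow> real) \<Rightarrow> (nat \<Rightarrow> real) \<Rightarrow> real" where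
  "partial_deriv n i f = (\<lambda>x\<in>rpow {..<n}. deriv (\<lambda>s. f (x(i := s))) (x i))"

text \<open>Since all elements of \<open>rpow {..<n}\<close> take the same value outside \<open>{..<n}\<close>, the subspace
  topology inherited from the product topology on \<open>nat \<Rightarrow> real\<close> is that of Euclidean
  \<open>n\<close>-space.\<close>

fun Ck :: "nat \<Rightarrow> nat \<Rightarrow> ((nat \<Rightarrow> real) \<Rightarrow> real) \<Rightarrow> bool" where
  "Ck n 0 f \<longleftrightarrow> continuous_on (rpow {..<n}) f"
| "Ck n (Suc k) f \<longleftrightarrow> continuous_on (rpow {..<n}) f \<and>
     (\<forall>i<n. (\<forall>x\<in>rpow {..<n}. (\<lambda>s. f (x(i := s))) field_differentiable (at (x i))) \<and>
            Ck n k (partial_deriv n i f))"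

definition smooth :: "nat \<Rightarrow> ((nat \<Rightarrow> real) \<Rightarrow> real) set" where
  "smooth n = {f \<in> extensional (rpow {..<n}). \<forall>k. Ck n k f}"

definition smooth_proj :: "nat \<Rightarrow> nat \<Rightarrow> (nat \<Rightarrow> real) \<Rightarrow> real" where
  "smooth_proj n k = (\<lambda>t\<in>rpow {..<n}. t k)"

definition smooth_comp ::
  "'i set \<Rightarrow> nat \<Rightarrow> ((nat \<Rightarrow> real) \<Rightarrow> real) \<Rightarrow> (nat \<Rightarrow> ('i \<Rightarrow> real) \<Rightarrow> real) \<Rightarrow> ('i \<Rightarrow> real) \<Rightarrow> real" where
  "smooth_comp I n f g = (\<lambda>t\<in>rpow I. f (\<lambda>i\<in>{..<n}. g i t))"


section \<open>\<open>C\<^sup>\<infinity>\<close>-rings and their homomorphisms\<close>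

text \<open>The arity is an argument of \<open>interp\<close> because a function
  \<open>(nat \<Rightarrow> real) \<Rightarrow> real\<close> need not determine the \<open>n\<close> for which it is a smooth function of
  \<open>n\<close> variables.  Values of \<open>interp A n f a\<close> with \<open>f \<notin> smooth n\<close> or
  \<open>a \<notin> tuples n (carrier A)\<close> are irrelevant.  Indices run from \<open>0\<close> to \<open>n - 1\<close>.\<close>

record 'a cinf_struct =
  carrier :: "'a set"
  interp :: "nat \<Rightarrow> ((nat \<Rightarrow> real) \<Rightarrow> real) \<Rightarrow> (nat \<Rightarrow> 'a) \<Rightarrow> 'a"

definition cinf_structure :: "'a cinf_struct \<Rightarrow> bool" where
  "cinf_structure A \<longleftrightarrow>
     (\<forall>n. \<forall>f\<in>smooth n. \<forall>a\<in>tuples n (carrier A). interp A n f a \<in> carrier A)"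

definition cinf_ring :: "'a cinf_struct \<Rightarrow> bool" where
  "cinf_ring A \<longleftrightarrow> cinf_structure A \<and>
     (\<forall>n. \<forall>k<n. \<forall>a\<in>tuples n (carrier A). interp A n (smooth_proj n k) a = a k) \<and>
     (\<forall>n k. \<forall>f\<in>smooth n. \<forall>g\<in>tuples n (smooth k). \<forall>h\<in>smooth k.
        h = smooth_comp {..<k} n f g \<longrightarrow>
        (\<forall>a\<in>tuples k (carrier A).
           interp A k h a = interp A n f (\<lambda>i\<in>{..<n}. interp A k (g i) a)))"

definition cinf_hom :: "'a cinf_struct \<Rightarrow> 'b cinf_struct \<Rightarrow> ('a \<Rightarrow> 'b) set" where
  "cinf_hom A B = {\<phi> \<in> carrier A \<rightarrow>\<^sub>E carrier B.
     \<forall>n. \<forall>f\<in>smooth n. \<forall>a\<in>tuples n (carrier A).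
       \<phi> (interp A n f a) = interp B n f (\<lambda>i\<in>{..<n}. \<phi> (a i))}"

text \<open>In the category of sets, a morphism from \<open>X\<close> to \<open>Y\<close> is an element of \<open>X \<rightarrow>\<^sub>E Y\<close>, and
  composition of morphisms (of sets and of \<open>C\<^sup>\<infinity>\<close>-rings) is \<^const>\<open>compose\<close>.\<close>

definition forget_obj :: "'a cinf_struct \<Rightarrow> 'a set" where
  "forget_obj A = carrier A"

definition forget_map :: "('a \<Rightarrow> 'b) \<Rightarrow> 'a \<Rightarrow> 'b" where
  "forget_map \<phi> = \<phi>"


section \<open>The free \<open>C\<^sup>\<infinity>\<close>-ring on a set\<close>

definition fin_carrier :: "'x set \<Rightarrow> (('x \<Rightarrow> real) \<Rightarrow> real) set" where
  "fin_carrier X = {\<lambda>t\<in>rpow X. g (\<lambda>i\<in>{..<n}. t (e i)) | n e g.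
     bij_betw e {..<n} X \<and> g \<in> smooth n}"

definition fin_free :: "'x set \<Rightarrow> (('x \<Rightarrow> real) \<Rightarrow> real) cinf_struct" where
  "fin_free X = \<lparr>carrier = fin_carrier X, interp = smooth_comp X\<rparr>"

text \<open>For finite \<open>E' \<subseteq> E\<close> this is the transition map of the directed system if \<open>E\<close> is finite, and
  the canonical map into the colimit if \<open>E\<close> is arbitrary.  The transition maps are injective, so
  the colimit is realised by functions on \<open>rpow E\<close> that depend smoothly on finitely many variables;
  \<open>free_obj_colimit\<close> below shows that this is indeed the directed colimit, and
  \<open>free_obj_finite\<close> that it agrees with \<open>fin_free\<close> on finite sets.\<close>

definition pull :: "'x set \<Rightarrow> 'x set \<Rightarrow> (('x \<Rightarrow> real) \<Rightarrow> real) \<Rightarrow> ('x \<Rightarrow> real) \<Rightarrow> real" where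
  "pull E' E = (\<lambda>g\<in>fin_carrier E'. \<lambda>t\<in>rpow E. g (restrict t E'))"

definition free_obj :: "'x set \<Rightarrow> (('x \<Rightarrow> real) \<Rightarrow> real) cinf_struct" where
  "free_obj E = \<lparr>carrier = (\<Union>E'\<in>{E'. finite E' \<and> E' \<subseteq> E}. pull E' E ` fin_carrier E'),
                 interp = smooth_comp E\<rparr>"

definition free_gen :: "'x set \<Rightarrow> 'x \<Rightarrow> ('x \<Rightarrow> real) \<Rightarrow> real" where
  "free_gen E = (\<lambda>x\<in>E. \<lambda>t\<in>rpow E. t x)"

definition free_map ::
  "'x set \<Rightarrow> 'y set \<Rightarrow> ('x \<Rightarrow> 'y) \<Rightarrow> (('x \<Rightarrow> real) \<Rightarrow> real) \<Rightarrow> (('y \<Rightarrow> real) \<Rightarrow> real)" where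
  "free_map X Y f = (THE \<phi>. \<phi> \<in> cinf_hom (free_obj X) (free_obj Y) \<and>
     compose X (forget_map \<phi>) (free_gen X) = compose X (free_gen Y) f)"

text \<open>The adjunction map \<open>Hom(L X, A) \<rightarrow> Hom(X, U A)\<close>.\<close>

definition adj_map :: "'x set \<Rightarrow> ((('x \<Rightarrow> real) \<Rightarrow> real) \<Rightarrow> 'a) \<Rightarrow> 'x \<Rightarrow> 'a" where
  "adj_map X \<phi> = compose X (forget_map \<phi>) (free_gen X)"


section \<open>Smooth functions are closed under composition\<close>

lemma rpow_upd [simp]: "x \<in> rpow I \<Longrightarrow> i \<in> I \<Longrightarrow> x(i := s) \<in> rpow I"
  by (auto simp: rpow_def PiE_iff extensional_def)

lemma restrict_in_rpow [simp]: "restrict t I \<in> rpow I"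
  by (auto simp: rpow_def)

lemma partial_deriv_cong:
  assumes "\<And>x. x \<in> rpow {..<n} \<Longrightarrow> f x = g x" "i < n"
  shows "partial_deriv n i f = partial_deriv n i g"
proof
  fix x
  have "(\<lambda>s. f (x(i := s))) = (\<lambda>s. g (x(i := s)))" if "x \<in> rpow {..<n}"
    using that assms by auto
  then show "partial_deriv n i f x = partial_deriv n i g x"
    by (auto simp: partial_deriv_def restrict_def)
qed

lemma Ck_cong:
  assumes "\<And>x. x \<in> rpow {..<n} \<Longrightarrow> f x = g x"
  shows "Ck n k f \<longleftrightarrow> Ck n k g"
proof -
  have c: "continuous_on (rpow {..<n}) f \<longleftrightarrow> continuous_on (rpow {..<n}) g"
    using assms by (intro continuous_on_cong) auto
  have s: "(\<lambda>s. f (x(i := s))) = (\<lambda>s. g (x(i := s)))" if "x \<in> rpow {..<n}" "i < n" for x i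
    using that assms by auto
  show ?thesis
    using c s partial_deriv_cong[of n f g, OF assms] by (cases k) (auto cong: conj_cong)
qed

lemma Ck_Suc_D: "Ck n (Suc k) f \<Longrightarrow> Ck n k f"
proof (induction k arbitrary: f)
  case (Suc k)
  then show ?case by (metis Ck.simps(2))
qed auto

lemma Ck_const: "Ck n k (\<lambda>x. c)"
proof (induction k arbitrary: c)
  case (Suc k)
  have "Ck n k (partial_deriv n i (\<lambda>x. c))" for i
    using Suc[of 0] Ck_cong[of n "\<lambda>x. 0" "partial_deriv n i (\<lambda>x. c)" k]
    by (simp add: partial_deriv_def)
  then show ?case by auto
qed auto

lemma Ck_proj: "j < n \<Longrightarrow> Ck n k (\<lambda>x. x j)"
proof (cases k)
  case (Suc k')
  have cont: "continuous_on (rpow {..<n}) (\<lambda>x. x j :: real)"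
    by (rule continuous_on_subset[OF continuous_on_product_coordinates]) auto
  have e: "partial_deriv n i (\<lambda>x. x j) x = (if i = j then 1 else 0)" if "x \<in> rpow {..<n}" for i x
    using that by (auto simp: partial_deriv_def)
  have "Ck n k' (partial_deriv n i (\<lambda>x. x j))" for i
    using Ck_cong[of n "partial_deriv n i (\<lambda>x. x j)" "\<lambda>x. if i = j then 1 else 0" k', OF e] Ck_const by auto
  moreover have "(\<lambda>s. (x(i := s)) j) field_differentiable at (x i)" for x :: "nat \<Rightarrow> real" and i
    by (cases "i = j") auto
  ultimately show ?thesis using Suc cont by auto
qed (auto intro!: continuous_on_subset[OF continuous_on_product_coordinates])

lemma has_partial_deriv:
  assumes "Ck n (Suc k) f" "x \<in> rpow {..<n}" "i < n"
  shows "((\<lambda>s. f (x(i := s))) has_real_derivative partial_deriv n i f x) (at (x i))"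
  using assms by (auto simp: partial_deriv_def dest: field_differentiable_derivI)

lemma partial_derivI:
  assumes "((\<lambda>s. f (x(i := s))) has_real_derivative d) (at (x i))" "x \<in> rpow {..<n}"
  shows "partial_deriv n i f x = d" "(\<lambda>s. f (x(i := s))) field_differentiable at (x i)"
  using assms by (auto simp: partial_deriv_def DERIV_imp_deriv field_differentiable_def)

lemma Ck_SucI:
  assumes c: "Ck n 0 f"
    and d: "\<And>i x. i < n \<Longrightarrow> x \<in> rpow {..<n} \<Longrightarrow>
              ((\<lambda>s. f (x(i := s))) has_real_derivative d i x) (at (x i))"
    and k: "\<And>i. i < n \<Longrightarrow> Ck n k (d i)"
  shows "Ck n (Suc k) f"
proof -
  have "Ck n k (partial_deriv n i f)" if "i < n" for i
  proof -
    have "partial_deriv n i f x = d i x" if x: "x \<in> rpow {..<n}" for x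
      by (rule partial_derivI(1)[OF d[OF \<open>i < n\<close> x] x])
    then show ?thesis using k[OF that] Ck_cong[of n "partial_deriv n i f" "d i" k] by blast
  qed
  moreover have "(\<lambda>s. f (x(i := s))) field_differentiable at (x i)"
    if "i < n" "x \<in> rpow {..<n}" for i x
    using partial_derivI(2)[OF d[OF that] that(2)] .
  ultimately show ?thesis using c by auto
qed

lemma Ck_continuous: "Ck n k f \<Longrightarrow> continuous_on (rpow {..<n}) f"
  by (cases k) auto

lemma Ck_add: "Ck n k f \<Longrightarrow> Ck n k g \<Longrightarrow> Ck n k (\<lambda>x. f x + g x)"
proof (induction k arbitrary: f g)
  case (Suc k)
  show ?case
  proof (rule Ck_SucI[where d = "\<lambda>i x. partial_deriv n i f x + partial_deriv n i g x"])
    show "Ck n 0 (\<lambda>x. f x + g x)"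
      using Suc.prems by (auto intro: continuous_on_add)
    show "Ck n k (\<lambda>x. partial_deriv n i f x + partial_deriv n i g x)" if "i < n" for i
      using Suc.prems Suc.IH that by auto
    show "((\<lambda>s. f (x(i := s)) + g (x(i := s))) has_real_derivative
            partial_deriv n i f x + partial_deriv n i g x) (at (x i))"
      if "i < n" "x \<in> rpow {..<n}" for i x
      using that Suc.prems by (auto intro!: DERIV_add has_partial_deriv)
  qed
qed (auto intro: continuous_on_add)

lemma Ck_mult: "Ck n k f \<Longrightarrow> Ck n k g \<Longrightarrow> Ck n k (\<lambda>x. f x * g x)"
proof (induction k arbitrary: f g)
  case (Suc k)
  show ?case
  proof (rule Ck_SucI[where d = "\<lambda>i x. partial_deriv n i f x * g x + partial_deriv n i g x * f x"])
    show "Ck n 0 (\<lambda>x. f x * g x)"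
      using Suc.prems by (auto intro: continuous_on_mult)
    show "Ck n k (\<lambda>x. partial_deriv n i f x * g x + partial_deriv n i g x * f x)" if "i < n" for i
      using Suc.prems that by (intro Ck_add Suc.IH) (auto intro: Ck_Suc_D simp del: Ck.simps simp: Ck.simps(2)[of n k])
    show "((\<lambda>s. f (x(i := s)) * g (x(i := s))) has_real_derivative
            partial_deriv n i f x * g x + partial_deriv n i g x * f x) (at (x i))"
      if "i < n" "x \<in> rpow {..<n}" for i x
      using DERIV_mult[OF has_partial_deriv[OF Suc.prems(1) that(2,1)] has_partial_deriv[OF Suc.prems(2) that(2,1)]]
      by (simp del: fun_upd_apply)
  qed
qed (auto intro: continuous_on_mult)

lemma Ck_sum: "(\<And>j. j \<in> J \<Longrightarrow> Ck n k (f j)) \<Longrightarrow> Ck n k (\<lambda>x. \<Sum>j\<in>J. f j x)"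
  by (induction J rule: infinite_finite_induct) (auto intro: Ck_const Ck_add)

lemma tendsto_coordinates:
  fixes g :: "'a \<Rightarrow> 'i \<Rightarrow> real"
  assumes "\<And>i. ((\<lambda>s. g s i) \<longlongrightarrow> l i) F"
  shows "(g \<longlongrightarrow> l) F"
  using assms limitin_componentwise[of "\<lambda>i. euclidean" UNIV g l F]
  by (simp add: euclidean_product_topology)

lemma MVT_sym:
  fixes f f' :: "real \<Rightarrow> real"
  assumes "\<And>x. (f has_real_derivative f' x) (at x)"
  shows "\<exists>z. \<bar>z - a\<bar> \<le> \<bar>b - a\<bar> \<and> f b - f a = (b - a) * f' z"
proof -
  consider "a < b" | "b < a" | "a = b" by linarith
  then show ?thesis
  proof cases
    case 1
    then obtain z where "a < z" "z < b" "f b - f a = (b - a) * f' z"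
      using MVT2[of a b f f'] assms by auto
    then show ?thesis by (intro exI[of _ z]) auto
  next
    case 2
    then obtain z where "b < z" "z < a" "f a - f b = (a - b) * f' z"
      using MVT2[of b a f f'] assms by auto
    then show ?thesis by (intro exI[of _ z]) (auto simp: algebra_simps)
  qed (auto intro: exI[of _ a])
qed

lemma DERIV_along_curve:
  fixes \<gamma> :: "real \<Rightarrow> nat \<Rightarrow> real"
  assumes f: "Ck m (Suc 0) f"
    and \<gamma>: "\<And>s. \<gamma> s \<in> rpow {..<m}"
    and d: "\<And>j. j < m \<Longrightarrow> ((\<lambda>s. \<gamma> s j) has_real_derivative d j) (at s0)"
  shows "((\<lambda>s. f (\<gamma> s)) has_real_derivative (\<Sum>j<m. partial_deriv m j f (\<gamma> s0) * d j)) (at s0)"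
proof -
  define \<delta> where "\<delta> j s = (\<lambda>i. if i < j then \<gamma> s i else \<gamma> s0 i)" for j s
  have ext: "\<gamma> s i = undefined" if "\<not> i < m" for s i
    using \<gamma>[of s] that by (auto simp: rpow_def PiE_iff extensional_def)
  have \<delta>: "\<delta> j s \<in> rpow {..<m}" for j s
    using ext by (auto simp: rpow_def PiE_iff extensional_def \<delta>_def)
  have step: "((\<lambda>s. f (\<delta> (Suc j) s) - f (\<delta> j s)) has_real_derivative
                 partial_deriv m j f (\<gamma> s0) * d j) (at s0)" if j: "j < m" for j
  proof -
    have "\<exists>z. \<bar>z - \<gamma> s0 j\<bar> \<le> \<bar>\<gamma> s j - \<gamma> s0 j\<bar> \<and>
            f ((\<delta> j s)(j := \<gamma> s j)) - f ((\<delta> j s)(j := \<gamma> s0 j)) =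
            (\<gamma> s j - \<gamma> s0 j) * partial_deriv m j f ((\<delta> j s)(j := z))" for s
    proof (rule MVT_sym)
      fix x
      show "((\<lambda>x. f ((\<delta> j s)(j := x))) has_real_derivative
               partial_deriv m j f ((\<delta> j s)(j := x))) (at x)"
        using has_partial_deriv[OF f rpow_upd[OF \<delta>], of j j j s x] j by auto
    qed
    then obtain z where z: "\<bar>z s - \<gamma> s0 j\<bar> \<le> \<bar>\<gamma> s j - \<gamma> s0 j\<bar>"
      "f ((\<delta> j s)(j := \<gamma> s j)) - f ((\<delta> j s)(j := \<gamma> s0 j)) =
            (\<gamma> s j - \<gamma> s0 j) * partial_deriv m j f ((\<delta> j s)(j := z s))" for s
      by metis
    have upd: "(\<delta> j s)(j := \<gamma> s j) = \<delta> (Suc j) s" "(\<delta> j s)(j := \<gamma> s0 j) = \<delta> j s" for s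
      by (auto simp: \<delta>_def fun_eq_iff less_Suc_eq)
    have tends: "((\<lambda>s. \<gamma> s i) \<longlongrightarrow> \<gamma> s0 i) (at s0)" for i
      using DERIV_isCont[OF d, of i] ext by (cases "i < m") (auto simp: isCont_def)
    have tz: "(z \<longlongrightarrow> \<gamma> s0 j) (at s0)"
    proof -
      have "((\<lambda>s. \<gamma> s j - \<gamma> s0 j) \<longlongrightarrow> 0) (at s0)"
        using tends[of j] LIM_zero by blast
      then have "((\<lambda>s. z s - \<gamma> s0 j) \<longlongrightarrow> 0) (at s0)"
        by (rule Lim_null_comparison[rotated, OF tendsto_rabs_zero]) (use z(1) in auto)
      then show ?thesis using LIM_zero_cancel by blast
    qed
    have tz': "((\<lambda>s. (\<delta> j s)(j := z s)) \<longlongrightarrow> \<gamma> s0) (at s0)"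
    proof (rule tendsto_coordinates)
      fix i
      show "((\<lambda>s. ((\<delta> j s)(j := z s)) i) \<longlongrightarrow> \<gamma> s0 i) (at s0)"
        using tz tends[of i] by (cases "i = j"; cases "i < j") (auto simp: \<delta>_def)
    qed
    have "continuous_on (rpow {..<m}) (partial_deriv m j f)"
      using f j by auto
    then have lim: "((\<lambda>s. partial_deriv m j f ((\<delta> j s)(j := z s))) \<longlongrightarrow> partial_deriv m j f (\<gamma> s0)) (at s0)"
      by (rule continuous_on_tendsto_compose[OF _ tz' \<gamma>]) (use \<delta> j in auto)
    have "((\<lambda>s. ((\<gamma> s j - \<gamma> s0 j) / (s - s0)) * partial_deriv m j f ((\<delta> j s)(j := z s)))
            \<longlongrightarrow> d j * partial_deriv m j f (\<gamma> s0)) (at s0)"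
      using d[OF j] by (intro tendsto_mult lim) (simp add: has_field_derivative_iff)
    moreover have "f (\<delta> (Suc j) s0) - f (\<delta> j s0) = 0"
    proof -
      have "\<delta> (Suc j) s0 = \<delta> j s0" by (auto simp: \<delta>_def)
      then show ?thesis by simp
    qed
    ultimately show ?thesis
      using z(2) by (simp add: has_field_derivative_iff upd mult.commute)
  qed
  have "((\<lambda>s. f (\<gamma> s0) + (\<Sum>j<m. f (\<delta> (Suc j) s) - f (\<delta> j s))) has_real_derivative
           0 + (\<Sum>j<m. partial_deriv m j f (\<gamma> s0) * d j)) (at s0)"
    by (intro DERIV_add DERIV_const DERIV_sum step) auto
  moreover have "f (\<gamma> s0) + (\<Sum>j<m. f (\<delta> (Suc j) s) - f (\<delta> j s)) = f (\<gamma> s)" for s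
  proof -
    have "\<delta> m s = \<gamma> s" "\<delta> 0 s = \<gamma> s0" using ext by (auto simp: \<delta>_def fun_eq_iff)
    then show ?thesis using sum_lessThan_telescope[of "\<lambda>j. f (\<delta> j s)" m] by simp
  qed
  ultimately show ?thesis by simp
qed

lemma Ck_comp:
  assumes "Ck m k f" "\<And>j. j < m \<Longrightarrow> Ck n k (g j)"
  shows "Ck n k (\<lambda>t. f (\<lambda>j\<in>{..<m}. g j t))"
  using assms
proof (induction k arbitrary: f)
  case 0
  have g0: "continuous_on (rpow {..<n}) (\<lambda>t. \<lambda>j\<in>{..<m}. g j t)"
  proof (rule continuous_on_coordinatewise_then_product)
    fix i
    show "continuous_on (rpow {..<n}) (\<lambda>t. (\<lambda>j\<in>{..<m}. g j t) i)"
      using 0 by (cases "i < m") auto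
  qed
  then show ?case
    using 0 continuous_on_compose2[OF _ g0, of "rpow {..<m}" f]
    by (simp add: image_subset_iff del: restrict_apply)
next
  case (Suc k)
  let ?G = "\<lambda>t. \<lambda>j\<in>{..<m}. g j t"
  have g0: "continuous_on (rpow {..<n}) ?G"
  proof (rule continuous_on_coordinatewise_then_product)
    fix i
    show "continuous_on (rpow {..<n}) (\<lambda>t. ?G t i)"
      using Suc.prems(2) by (cases "i < m") (auto dest: Ck_continuous)
  qed
  show ?case
  proof (rule Ck_SucI[where d = "\<lambda>i t. \<Sum>j<m. partial_deriv m j f (?G t) * partial_deriv n i (g j) t"])
    show "Ck n 0 (\<lambda>t. f (?G t))"
      using Suc.prems(1) continuous_on_compose2[OF _ g0, of "rpow {..<m}" f]
      by (simp add: image_subset_iff del: restrict_apply)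
  next
    fix i assume i: "i < n"
    have "Ck n k (\<lambda>t. partial_deriv m j f (?G t))" if "j < m" for j
      using Suc.prems(1) that Ck_Suc_D[OF Suc.prems(2)] by (intro Suc.IH) auto
    then show "Ck n k (\<lambda>t. \<Sum>j<m. partial_deriv m j f (?G t) * partial_deriv n i (g j) t)"
      using Suc.prems(2) i by (intro Ck_sum Ck_mult) auto
  next
    fix i x assume i: "i < n" and x: "x \<in> rpow {..<n}"
    have f1: "Ck m (Suc 0) f"
      using Suc.prems(1) by (auto dest: Ck_continuous)
    have "((\<lambda>s. f (?G (x(i := s)))) has_real_derivative
             (\<Sum>j<m. partial_deriv m j f (?G (x(i := x i))) * partial_deriv n i (g j) x)) (at (x i))"
    proof (rule DERIV_along_curve[OF f1])
      fix j assume j: "j < m"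
      show "((\<lambda>s. ?G (x(i := s)) j) has_real_derivative partial_deriv n i (g j) x) (at (x i))"
        using has_partial_deriv[OF Suc.prems(2)[OF j] x i] j by (simp del: fun_upd_apply)
    qed auto
    then show "((\<lambda>s. f (?G (x(i := s)))) has_real_derivative
             (\<Sum>j<m. partial_deriv m j f (?G x) * partial_deriv n i (g j) x)) (at (x i))"
      by simp
  qed
qed

lemma smooth_comp_smooth:
  assumes "f \<in> smooth n" "g \<in> tuples n (smooth k)"
  shows "smooth_comp {..<k} n f g \<in> smooth k"
proof -
  have "Ck k l (smooth_comp {..<k} n f g)" for l
  proof -
    have "Ck k l (\<lambda>t. f (\<lambda>j\<in>{..<n}. g j t))"
      using assms by (intro Ck_comp) (auto simp: smooth_def tuples_def PiE_iff)
    then show ?thesis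
      by (subst Ck_cong[where g = "\<lambda>t. f (\<lambda>j\<in>{..<n}. g j t)"]) (auto simp: smooth_comp_def)
  qed
  then show ?thesis by (auto simp: smooth_def smooth_comp_def)
qed

lemma smooth_proj_smooth: "k < n \<Longrightarrow> smooth_proj n k \<in> smooth n"
proof -
  assume "k < n"
  then have "Ck n l (smooth_proj n k)" for l
    using Ck_proj Ck_cong[of n "smooth_proj n k" "\<lambda>x. x k" l] by (auto simp: smooth_proj_def)
  then show ?thesis by (auto simp: smooth_def smooth_proj_def)
qed



section \<open>The free \<open>C\<^sup>\<infinity>\<close>-ring as a directed colimit\<close>

lemma cinf_ring_of_functions:
  assumes "S \<subseteq> extensional (rpow I)"
    and "\<And>n f g. f \<in> smooth n \<Longrightarrow> g \<in> tuples n S \<Longrightarrow> smooth_comp I n f g \<in> S"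
  shows "cinf_ring \<lparr>carrier = S, interp = smooth_comp I\<rparr>"
proof -
  have "smooth_comp I n (smooth_proj n k) a = a k" if "k < n" "a \<in> tuples n S" for n k a
  proof -
    have "a k \<in> extensional (rpow I)" using that assms(1) by (auto simp: tuples_def)
    then show ?thesis
      using that(1) by (intro extensionalityI[of _ "rpow I"]) (auto simp: smooth_comp_def smooth_proj_def)
  qed
  moreover have "smooth_comp I k (smooth_comp {..<k} n f g) a =
      smooth_comp I n f (\<lambda>i\<in>{..<n}. smooth_comp I k (g i) a)" for n k f g a
  proof -
    have "(\<lambda>i\<in>{..<n}. (\<lambda>i\<in>{..<n}. smooth_comp I k (g i) a) i t) =
          (\<lambda>i\<in>{..<n}. g i (\<lambda>i\<in>{..<k}. a i t))" if "t \<in> rpow I" for t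
      using that by (intro restrict_ext) (simp add: smooth_comp_def del: restrict_apply add: restrict_apply')
    then show ?thesis
      unfolding smooth_comp_def[of I k "smooth_comp {..<k} n f g"] smooth_comp_def[of I n]
      by (intro restrict_ext) (simp add: smooth_comp_def[of "{..<k}"] del: restrict_apply add: restrict_apply')
  qed
  ultimately show ?thesis
    using assms(2) by (auto simp: cinf_ring_def cinf_structure_def)
qed

lemma smooth_reindex:
  assumes d: "bij_betw d {..<n} X" and e: "e \<in> {..<m} \<rightarrow> X" and f: "f \<in> smooth m"
  shows "\<exists>g\<in>smooth n. \<forall>t. f (\<lambda>i\<in>{..<m}. t (e i)) = g (\<lambda>i\<in>{..<n}. t (d i))"
proof -
  define c where "c = inv_into {..<n} d"
  have c: "c x < n" "d (c x) = x" if "x \<in> X" for x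
    using that d bij_betw_inv_into_right[OF d] bij_betw_apply[OF bij_betw_inv_into[OF d]]
    by (auto simp: c_def)
  define g where "g = smooth_comp {..<n} m f (\<lambda>i\<in>{..<m}. smooth_proj n (c (e i)))"
  have "g \<in> smooth n"
    unfolding g_def using f e c
    by (intro smooth_comp_smooth) (auto simp: tuples_def intro!: smooth_proj_smooth)
  moreover have "f (\<lambda>i\<in>{..<m}. t (e i)) = g (\<lambda>i\<in>{..<n}. t (d i))" for t
  proof -
    have "(\<lambda>i\<in>{..<m}. (\<lambda>i\<in>{..<m}. smooth_proj n (c (e i))) i (\<lambda>i\<in>{..<n}. t (d i))) =
          (\<lambda>i\<in>{..<m}. t (e i))"
      using e c by (intro restrict_ext)
        (auto simp: smooth_proj_def Pi_iff restrict_apply' simp del: restrict_apply)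
    then show ?thesis
      by (simp add: g_def smooth_comp_def restrict_apply' del: restrict_apply)
  qed
  ultimately show ?thesis by blast
qed

lemma fin_carrierI:
  assumes "finite X" "e \<in> {..<m} \<rightarrow> X" "g \<in> smooth m"
  shows "(\<lambda>t\<in>rpow X. g (\<lambda>i\<in>{..<m}. t (e i))) \<in> fin_carrier X"
proof -
  obtain n and d :: "nat \<Rightarrow> 'a" where d: "bij_betw d {..<n} X"
    using assms(1) ex_bij_betw_nat_finite[of X] by (auto simp: lessThan_atLeast0)
  show ?thesis
    using smooth_reindex[OF d assms(2,3)] d unfolding fin_carrier_def by (auto simp del: restrict_apply) blast
qed

lemma fin_carrierE:
  assumes "h \<in> fin_carrier X"
  obtains n e g where "bij_betw e {..<n} X" "g \<in> smooth n"
    "h = (\<lambda>t\<in>rpow X. g (\<lambda>i\<in>{..<n}. t (e i)))"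
  using assms by (auto simp: fin_carrier_def)

lemma fin_carrier_extensional: "fin_carrier X \<subseteq> extensional (rpow X)"
  by (auto simp: fin_carrier_def)

lemma fin_carrier_enum:
  assumes "h \<in> fin_carrier X" "bij_betw d {..<n} X"
  shows "\<exists>g\<in>smooth n. h = (\<lambda>t\<in>rpow X. g (\<lambda>i\<in>{..<n}. t (d i)))"
proof -
  obtain m e f where e: "bij_betw e {..<m} X" and f: "f \<in> smooth m"
    and h: "h = (\<lambda>t\<in>rpow X. f (\<lambda>i\<in>{..<m}. t (e i)))"
    using assms(1) by (rule fin_carrierE)
  have "e \<in> {..<m} \<rightarrow> X" using bij_betw_apply[OF e] by auto
  from smooth_reindex[OF assms(2) this f] show ?thesis by (auto simp: h)
qed

lemma fin_carrier_closed:
  assumes "finite X" "f \<in> smooth n" "g \<in> tuples n (fin_carrier X)"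
  shows "smooth_comp X n f g \<in> fin_carrier X"
proof -
  obtain k and d :: "nat \<Rightarrow> 'a" where d: "bij_betw d {..<k} X"
    using assms(1) ex_bij_betw_nat_finite[of X] by (auto simp: lessThan_atLeast0)
  have "\<exists>h\<in>smooth k. g i = (\<lambda>t\<in>rpow X. h (\<lambda>i\<in>{..<k}. t (d i)))" if "i < n" for i
    using assms(3) that by (intro fin_carrier_enum d) (auto simp: tuples_def)
  then obtain h where h: "\<And>i. i < n \<Longrightarrow> h i \<in> smooth k"
    "\<And>i. i < n \<Longrightarrow> g i = (\<lambda>t\<in>rpow X. h i (\<lambda>i\<in>{..<k}. t (d i)))"
    by metis
  have "smooth_comp {..<k} n f (restrict h {..<n}) \<in> smooth k"
    using h(1) assms(2) by (intro smooth_comp_smooth) (auto simp: tuples_def)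
  moreover have "smooth_comp X n f g =
      (\<lambda>t\<in>rpow X. smooth_comp {..<k} n f (restrict h {..<n}) (\<lambda>i\<in>{..<k}. t (d i)))"
    unfolding smooth_comp_def
  proof (rule restrict_ext)
    fix t :: "'a \<Rightarrow> real" assume t: "t \<in> rpow X"
    have "(\<lambda>i\<in>{..<n}. g i t) = (\<lambda>i\<in>{..<n}. restrict h {..<n} i (\<lambda>i\<in>{..<k}. t (d i)))"
      using t by (intro restrict_ext) (simp add: h(2) del: restrict_apply add: restrict_apply')
    then show "f (\<lambda>i\<in>{..<n}. g i t) =
        (\<lambda>t\<in>rpow {..<k}. f (\<lambda>i\<in>{..<n}. restrict h {..<n} i t)) (\<lambda>i\<in>{..<k}. t (d i))"
      by (simp del: restrict_apply add: restrict_apply')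
  qed
  ultimately show ?thesis
    using d by (auto simp: fin_carrier_def)
qed

lemma cinf_ring_fin_free: "finite X \<Longrightarrow> cinf_ring (fin_free X)"
  unfolding fin_free_def
  by (intro cinf_ring_of_functions fin_carrier_extensional fin_carrier_closed)

lemma pull_apply: "g \<in> fin_carrier E' \<Longrightarrow> pull E' E g = (\<lambda>t\<in>rpow E. g (restrict t E'))"
  by (simp add: pull_def)

lemma pull_extensional: "pull E' E \<in> extensional (fin_carrier E')"
  by (simp add: pull_def)

lemma pull_fin_carrier:
  assumes "finite E''" "E' \<subseteq> E''" "g \<in> fin_carrier E'"
  shows "pull E' E'' g \<in> fin_carrier E''"
proof -
  obtain n e f where e: "bij_betw e {..<n} E'" "f \<in> smooth n"
    "g = (\<lambda>t\<in>rpow E'. f (\<lambda>i\<in>{..<n}. t (e i)))"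
    using assms(3) by (rule fin_carrierE)
  have eE: "e i \<in> E'" if "i < n" for i using bij_betw_apply[OF e(1)] that by auto
  have "pull E' E'' g = (\<lambda>t\<in>rpow E''. f (\<lambda>i\<in>{..<n}. t (e i)))"
    unfolding pull_apply[OF assms(3)]
  proof (rule restrict_ext)
    fix t :: "'a \<Rightarrow> real"
    have "(\<lambda>i\<in>{..<n}. restrict t E' (e i)) = (\<lambda>i\<in>{..<n}. t (e i))"
      using eE by (intro restrict_ext) auto
    then show "g (restrict t E') = f (\<lambda>i\<in>{..<n}. t (e i))"
      by (simp add: e(3) del: restrict_apply add: restrict_apply')
  qed
  then show ?thesis
    using fin_carrierI[of E'' e n f] assms e eE by auto
qed

lemma pull_pull:
  assumes "finite E''" "E' \<subseteq> E''" "E'' \<subseteq> E" "g \<in> fin_carrier E'"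
  shows "pull E'' E (pull E' E'' g) = pull E' E g"
proof -
  have "restrict (restrict t E'') E' = restrict t E'" for t :: "'a \<Rightarrow> real"
    using assms(2) by (auto simp: fun_eq_iff restrict_def)
  then show ?thesis
    unfolding pull_apply[OF pull_fin_carrier[OF assms(1,2,4)]]
    by (simp add: pull_apply[OF assms(4)] restrict_apply' cong: restrict_cong del: restrict_apply restrict_restrict)
qed

lemma pull_inj:
  assumes "E' \<subseteq> E"
  shows "inj_on (pull E' E) (fin_carrier E')"
proof (rule inj_onI)
  fix g h assume gh: "g \<in> fin_carrier E'" "h \<in> fin_carrier E'" "pull E' E g = pull E' E h"
  show "g = h"
  proof (rule extensionalityI[of _ "rpow E'"])
    fix t assume t: "t \<in> rpow E'"
    have "restrict (restrict t E) E' = t"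
      using t assms by (auto simp: rpow_def fun_eq_iff restrict_def PiE_iff extensional_def)
    then show "g t = h t"
      using fun_cong[OF gh(3), of "restrict t E"] gh(1,2) by (simp add: pull_apply del: restrict_apply add: restrict_apply')
  qed (use gh fin_carrier_extensional in auto)
qed

lemma pull_self: "g \<in> fin_carrier X \<Longrightarrow> pull X X g = g"
proof (rule extensionalityI[of _ "rpow X"])
  assume g: "g \<in> fin_carrier X"
  show "pull X X g \<in> extensional (rpow X)" "g \<in> extensional (rpow X)"
    using g fin_carrier_extensional by (auto simp: pull_apply)
  fix t assume "t \<in> rpow X"
  moreover from this have "restrict t X = t" by (auto simp: rpow_def)
  ultimately show "pull X X g t = g t" using g by (simp add: pull_apply)
qed

lemma pull_smooth_comp:
  assumes "finite E'" "f \<in> smooth n" "a \<in> tuples n (fin_carrier E')"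
  shows "pull E' E (smooth_comp E' n f a) = smooth_comp E n f (\<lambda>i\<in>{..<n}. pull E' E (a i))"
proof -
  have "f (\<lambda>i\<in>{..<n}. a i (restrict t E')) = f (\<lambda>i\<in>{..<n}. (\<lambda>i\<in>{..<n}. pull E' E (a i)) i t)"
    if "t \<in> rpow E" for t
    using that assms(3) by (intro arg_cong[of _ _ f] restrict_ext) (auto simp: pull_apply tuples_def PiE_iff)
  then show ?thesis
    unfolding pull_apply[OF fin_carrier_closed[OF assms]]
    by (auto simp: smooth_comp_def intro!: restrict_ext simp del: restrict_apply simp add: restrict_apply')
qed

lemma free_obj_common:
  assumes "a \<in> tuples n (carrier (free_obj E))"
  shows "\<exists>F b. finite F \<and> F \<subseteq> E \<and> b \<in> tuples n (fin_carrier F) \<and> a = (\<lambda>i\<in>{..<n}. pull F E (b i))"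
proof -
  have "\<exists>E' g. finite E' \<and> E' \<subseteq> E \<and> g \<in> fin_carrier E' \<and> a i = pull E' E g" if "i < n" for i
  proof -
    have "a i \<in> carrier (free_obj E)" using assms that by (auto simp: tuples_def)
    then show ?thesis by (auto simp: free_obj_def)
  qed
  then obtain E' g where E': "\<And>i. i < n \<Longrightarrow> finite (E' i) \<and> E' i \<subseteq> E \<and> g i \<in> fin_carrier (E' i) \<and> a i = pull (E' i) E (g i)"
    by metis
  define F where "F = (\<Union>i<n. E' i)"
  define b where "b = (\<lambda>i\<in>{..<n}. pull (E' i) F (g i))"
  have F: "finite F" "F \<subseteq> E" "\<And>i. i < n \<Longrightarrow> E' i \<subseteq> F"
    using E' by (auto simp: F_def)
  have "b \<in> tuples n (fin_carrier F)"
    using E' F(1,3) by (simp add: b_def tuples_def pull_fin_carrier)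
  moreover have "a = (\<lambda>i\<in>{..<n}. pull F E (b i))"
    using E' F assms by (intro extensionalityI[of _ "{..<n}"]) (auto simp: b_def pull_pull tuples_def PiE_iff)
  ultimately show ?thesis using F by blast
qed

lemma cinf_ring_free_obj: "cinf_ring (free_obj E)"
proof -
  have "smooth_comp E n f a \<in> carrier (free_obj E)"
    if f: "f \<in> smooth n" and a: "a \<in> tuples n (carrier (free_obj E))" for n f a
  proof -
    obtain F b where "finite F" "F \<subseteq> E" "b \<in> tuples n (fin_carrier F)" "a = (\<lambda>i\<in>{..<n}. pull F E (b i))"
      using free_obj_common[OF a] by blast
    then have "smooth_comp E n f a \<in> pull F E ` fin_carrier F"
      using f fin_carrier_closed[of F f n b] pull_smooth_comp[of F f n b E]
      by (auto intro!: image_eqI)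
    then show ?thesis
      using \<open>finite F\<close> \<open>F \<subseteq> E\<close> by (auto simp: free_obj_def)
  qed
  then show ?thesis
    unfolding free_obj_def by (intro cinf_ring_of_functions) (auto simp: pull_apply)
qed

lemma free_obj_finite: "finite X \<Longrightarrow> free_obj X = fin_free X"
proof -
  assume X: "finite X"
  have "(\<Union>E'\<in>{E'. finite E' \<and> E' \<subseteq> X}. pull E' X ` fin_carrier E') = fin_carrier X"
    using X pull_fin_carrier by (auto intro!: bexI[of _ X] image_eqI[OF pull_self[symmetric]])
  then show ?thesis by (simp add: free_obj_def fin_free_def)
qed

lemma pull_hom:
  assumes "finite E''" "E' \<subseteq> E''"
  shows "pull E' E'' \<in> cinf_hom (fin_free E') (fin_free E'')"
  using assms pull_smooth_comp[OF finite_subset[OF assms(2,1)]]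
  by (auto simp: cinf_hom_def fin_free_def PiE_iff pull_extensional intro!: pull_fin_carrier)

lemma pull_hom_free_obj:
  assumes "finite E'" "E' \<subseteq> E"
  shows "pull E' E \<in> cinf_hom (fin_free E') (free_obj E)"
  using assms pull_smooth_comp[OF assms(1)]
  by (auto simp: cinf_hom_def fin_free_def free_obj_def PiE_iff pull_extensional)

lemma free_gen_eq_pull:
  assumes "finite E'" "E' \<subseteq> E" "x \<in> E'"
  shows "free_gen E x = pull E' E (free_gen E' x)"
proof -
  have "smooth_proj 1 0 \<in> smooth 1" by (intro smooth_proj_smooth) simp
  moreover have "(\<lambda>t\<in>rpow E'. smooth_proj 1 0 (\<lambda>i\<in>{..<1}. t x)) = free_gen E' x"
    using assms(3) by (simp add: free_gen_def smooth_proj_def del: restrict_apply add: restrict_apply')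
  ultimately have "free_gen E' x \<in> fin_carrier E'"
    using fin_carrierI[of E' "\<lambda>_. x" 1 "smooth_proj 1 0"] assms by auto
  then show ?thesis
    using assms by (auto simp: pull_apply free_gen_def fun_eq_iff subset_iff restrict_def [of _ "rpow E"] )
qed

theorem free_obj_colimit:
  assumes \<psi>: "\<And>E'. finite E' \<Longrightarrow> E' \<subseteq> E \<Longrightarrow> \<psi> E' \<in> cinf_hom (fin_free E') B"
    and compat: "\<And>E' E''. finite E'' \<Longrightarrow> E' \<subseteq> E'' \<Longrightarrow> E'' \<subseteq> E \<Longrightarrow>
      compose (carrier (fin_free E')) (\<psi> E'') (pull E' E'') = \<psi> E'"
  shows "\<exists>!\<eta>. \<eta> \<in> cinf_hom (free_obj E) B \<and>
    (\<forall>E'. finite E' \<longrightarrow> E' \<subseteq> E \<longrightarrow> compose (carrier (fin_free E')) \<eta> (pull E' E) = \<psi> E')"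
proof -
  have step: "\<psi> E'' (pull E' E'' g) = \<psi> E' g"
    if "finite E''" "E' \<subseteq> E''" "E'' \<subseteq> E" "g \<in> fin_carrier E'" for E' E'' g
    using fun_cong[OF compat[OF that(1-3)], of g] that(4) by (simp add: compose_def fin_free_def)
  have wd: "\<psi> E1 g1 = \<psi> E2 g2"
    if 1: "finite E1" "E1 \<subseteq> E" "g1 \<in> fin_carrier E1" and 2: "finite E2" "E2 \<subseteq> E" "g2 \<in> fin_carrier E2"
      and eq: "pull E1 E g1 = pull E2 E g2" for E1 E2 g1 g2
  proof -
    let ?F = "E1 \<union> E2"
    have "pull E1 ?F g1 = pull E2 ?F g2"
      by (rule inj_onD[OF pull_inj[of ?F E]])
        (use 1 2 eq in \<open>auto simp: pull_pull intro!: pull_fin_carrier\<close>)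
    then show ?thesis
      using step[of ?F E1 g1] step[of ?F E2 g2] 1 2 by auto
  qed
  define \<eta> where "\<eta> = (\<lambda>h\<in>carrier (free_obj E). THE b. \<exists>E' g. finite E' \<and> E' \<subseteq> E \<and>
    g \<in> fin_carrier E' \<and> h = pull E' E g \<and> b = \<psi> E' g)"
  have \<eta>: "\<eta> (pull E' E g) = \<psi> E' g" if "finite E'" "E' \<subseteq> E" "g \<in> fin_carrier E'" for E' g
  proof -
    have "pull E' E g \<in> carrier (free_obj E)" using that by (auto simp: free_obj_def)
    moreover have "(THE b. \<exists>E'' g'. finite E'' \<and> E'' \<subseteq> E \<and> g' \<in> fin_carrier E'' \<and>
        pull E' E g = pull E'' E g' \<and> b = \<psi> E'' g') = \<psi> E' g"
    proof (rule the_equality)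
      show "\<exists>E'' g'. finite E'' \<and> E'' \<subseteq> E \<and> g' \<in> fin_carrier E'' \<and>
          pull E' E g = pull E'' E g' \<and> \<psi> E' g = \<psi> E'' g'"
        by (intro exI[of _ E'] exI[of _ g]) (use that in simp)
    qed (use wd[OF that] in auto)
    ultimately show ?thesis by (simp add: \<eta>_def)
  qed
  have \<psi>B: "\<psi> E' g \<in> carrier B" if "finite E'" "E' \<subseteq> E" "g \<in> fin_carrier E'" for E' g
    using \<psi>[OF that(1,2)] that(3) by (auto simp: cinf_hom_def fin_free_def)
  have hom: "\<eta> \<in> cinf_hom (free_obj E) B"
  proof -
    have "\<eta> h \<in> carrier B" if "h \<in> carrier (free_obj E)" for h
      using that \<eta> \<psi>B by (auto simp: free_obj_def)
    moreover have "\<eta> (interp (free_obj E) n f a) = interp B n f (\<lambda>i\<in>{..<n}. \<eta> (a i))"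
      if f: "f \<in> smooth n" and a: "a \<in> tuples n (carrier (free_obj E))" for n f a
    proof -
      obtain F b where F: "finite F" "F \<subseteq> E" and b: "b \<in> tuples n (fin_carrier F)"
        and a: "a = (\<lambda>i\<in>{..<n}. pull F E (b i))"
        using free_obj_common[OF a] by blast
      have "\<eta> (interp (free_obj E) n f a) = \<eta> (pull F E (smooth_comp F n f b))"
        using pull_smooth_comp[OF F(1) f b, of E] a by (simp add: free_obj_def)
      also have "\<dots> = \<psi> F (smooth_comp F n f b)"
        using F f b by (intro \<eta> fin_carrier_closed) auto
      also have "\<dots> = interp B n f (\<lambda>i\<in>{..<n}. \<psi> F (b i))"
        using \<psi>[OF F] f b by (auto simp: cinf_hom_def fin_free_def)
      also have "(\<lambda>i\<in>{..<n}. \<psi> F (b i)) = (\<lambda>i\<in>{..<n}. \<eta> (a i))"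
        using F b by (intro restrict_ext) (auto simp: a \<eta> tuples_def PiE_iff)
      finally show ?thesis .
    qed
    moreover have "\<eta> \<in> extensional (carrier (free_obj E))" by (simp add: \<eta>_def)
    ultimately show ?thesis by (auto simp: cinf_hom_def PiE_iff)
  qed
  show ?thesis
  proof (rule ex1I[of _ \<eta>], intro conjI allI impI)
    fix E' assume E': "finite E'" "E' \<subseteq> E"
    have "\<psi> E' \<in> extensional (fin_carrier E')"
      using \<psi>[OF E'] by (auto simp: cinf_hom_def fin_free_def PiE_iff)
    then show "compose (carrier (fin_free E')) \<eta> (pull E' E) = \<psi> E'"
      using E' \<eta> by (intro extensionalityI[of _ "fin_carrier E'"]) (auto simp: fin_free_def compose_def)
  next
    fix \<xi> assume \<xi>: "\<xi> \<in> cinf_hom (free_obj E) B \<and>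
      (\<forall>E'. finite E' \<longrightarrow> E' \<subseteq> E \<longrightarrow> compose (carrier (fin_free E')) \<xi> (pull E' E) = \<psi> E')"
    have "\<xi> (pull E' E g) = \<psi> E' g" if "finite E'" "E' \<subseteq> E" "g \<in> fin_carrier E'" for E' g
    proof -
      have "compose (carrier (fin_free E')) \<xi> (pull E' E) = \<psi> E'" using \<xi> that by blast
      from fun_cong[OF this, of g] show ?thesis using that by (simp add: compose_def fin_free_def)
    qed
    then have "\<xi> h = \<eta> h" if "h \<in> carrier (free_obj E)" for h
      using that \<eta> by (auto simp: free_obj_def)
    then show "\<xi> = \<eta>"
      using \<xi> hom by (intro extensionalityI[of _ "carrier (free_obj E)"]) (auto simp: cinf_hom_def PiE_iff)
  qed (rule hom)
qed

end

theory Submission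
  imports Defs
begin

text \<open>Every element of \<^term>\<open>carrier (free_obj E)\<close> is a smooth function of finitely many coordinates,
  that is, the interpretation of a smooth \<open>g\<close> at generators indexed by \<open>e\<close>.  A homomorphism
  extending \<open>\<alpha>\<close> must therefore send it to the interpretation of \<open>g\<close> at the elements \<open>\<alpha> (e i)\<close>; this
  is independent of the presentation because any two presentations can be rewritten over a common
  injective enumeration of the coordinates, where the smooth function is determined by the element.
  Freeness makes \<^const>\<open>adj_map\<close> bijective, and functoriality and naturality follow because
  homomorphisms out of a free object are determined by their values on generators.\<close>

section \<open>Presentations of elements of the free \<open>C\<^sup>\<infinity>\<close>-ring\<close>

text \<open>In contrast to \<open>fin_carrier\<close>, \<open>e\<close> may repeat indices and miss
  points of \<open>E\<close>, so that every tuple of generators gives a presentation.\<close>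

definition cyl :: "'x set \<Rightarrow> nat \<Rightarrow> (nat \<Rightarrow> 'x) \<Rightarrow> ((nat \<Rightarrow> real) \<Rightarrow> real) \<Rightarrow> ('x \<Rightarrow> real) \<Rightarrow> real" where
  "cyl E n e g = (\<lambda>t\<in>rpow E. g (\<lambda>i\<in>{..<n}. t (e i)))"

text \<open>Since \<open>e\<close> lands in \<open>F\<close>, restricting \<open>t\<close> to
  \<open>F\<close> leaves each \<open>t (e i)\<close> unchanged. This links presentations to the
  directed colimit.\<close>

lemma cyl_eq_pull:
  assumes "finite F" "e \<in> {..<n} \<rightarrow> F" "g \<in> smooth n"
  shows "cyl E n e g = pull F E (cyl F n e g)"
proof -
  have "cyl F n e g \<in> fin_carrier F"
    unfolding cyl_def using assms by (rule fin_carrierI)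
  moreover have "(\<lambda>i\<in>{..<n}. restrict t F (e i)) = (\<lambda>i\<in>{..<n}. t (e i))" for t :: "'a \<Rightarrow> real"
    using assms(2) by (intro restrict_ext) auto
  ultimately show ?thesis
    unfolding cyl_def by (simp add: pull_apply del: restrict_apply add: restrict_apply')
qed

lemma cyl_in_carrier:
  assumes "e \<in> {..<n} \<rightarrow> E" "g \<in> smooth n"
  shows "cyl E n e g \<in> carrier (free_obj E)"
proof -
  \<comment> \<open>The image of \<open>e\<close> serves as the finite set of variables on which the
    function depends.\<close>
  let ?F = "e ` {..<n}"
  have "cyl E n e g = pull ?F E (cyl ?F n e g)"
    using assms by (intro cyl_eq_pull) auto
  moreover have "cyl ?F n e g \<in> fin_carrier ?F"
    unfolding cyl_def using assms by (intro fin_carrierI) auto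
  moreover have "?F \<in> {F. finite F \<and> F \<subseteq> E}" using assms by auto
  ultimately show ?thesis
    unfolding free_obj_def cinf_struct.select_convs by blast
qed

lemma free_gen_cyl: "x \<in> E \<Longrightarrow> free_gen E x = cyl E 1 (\<lambda>_. x) (smooth_proj 1 0)"
  by (simp add: free_gen_def cyl_def smooth_proj_def del: restrict_apply add: restrict_apply')

lemma free_gen_in_carrier: "x \<in> E \<Longrightarrow> free_gen E x \<in> carrier (free_obj E)"
  by (simp only: free_gen_cyl) (intro cyl_in_carrier smooth_proj_smooth, auto)

text \<open>This exhibits the generators as generating: a homomorphism has no freedom beyond its
  values on them.\<close>

lemma cyl_eq_interp:
  assumes "e \<in> {..<n} \<rightarrow> E"
  shows "cyl E n e g = interp (free_obj E) n g (\<lambda>i\<in>{..<n}. free_gen E (e i))"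
proof -
  have "(\<lambda>i\<in>{..<n}. (\<lambda>i\<in>{..<n}. free_gen E (e i)) i t) = (\<lambda>i\<in>{..<n}. t (e i))"
    if "t \<in> rpow E" for t
    using assms that by (intro restrict_ext) (auto simp: free_gen_def Pi_iff)
  then show ?thesis
    by (auto simp: cyl_def free_obj_def smooth_comp_def intro!: restrict_ext
        simp del: restrict_apply)
qed

text \<open>Over one fixed list \<open>d\<close> of coordinates, the operations act on the
  representing smooth functions by plain composition.\<close>

lemma interp_cyl:
  "interp (free_obj E) n f (\<lambda>i\<in>{..<n}. cyl E k d (g i)) = cyl E k d (smooth_comp {..<k} n f g)"
proof -
  have eq: "(\<lambda>i\<in>{..<n}. (\<lambda>i\<in>{..<n}. cyl E k d (g i)) i t) = (\<lambda>i\<in>{..<n}. g i (\<lambda>i\<in>{..<k}. t (d i)))"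
    if "t \<in> rpow E" for t
    using that by (intro restrict_ext) (auto simp: cyl_def)
  have "interp (free_obj E) n f (\<lambda>i\<in>{..<n}. cyl E k d (g i)) =
      (\<lambda>t\<in>rpow E. f (\<lambda>i\<in>{..<n}. g i (\<lambda>i\<in>{..<k}. t (d i))))"
    unfolding free_obj_def smooth_comp_def cinf_struct.select_convs
    by (rule restrict_ext) (simp only: eq)
  also have "\<dots> = cyl E k d (smooth_comp {..<k} n f g)"
    by (simp add: cyl_def smooth_comp_def restrict_apply' del: restrict_apply)
  finally show ?thesis .
qed

text \<open>Injectivity of \<open>d\<close> allows every point \<open>s\<close> of
  \<open>rpow {..<k}\<close> to be extended to a point \<open>t\<close> of \<open>rpow E\<close>
  with \<open>t (d i) = s i\<close>, so the element fixes all values of the smooth function.\<close>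

lemma cyl_inj:
  assumes d: "inj_on d {..<k}" "d \<in> {..<k} \<rightarrow> E"
    and gh: "g \<in> smooth k" "h \<in> smooth k" "cyl E k d g = cyl E k d h"
  shows "g = h"
proof (rule extensionalityI[of _ "rpow {..<k}"])
  fix s :: "nat \<Rightarrow> real" assume s: "s \<in> rpow {..<k}"
  \<comment> \<open>On \<open>E\<close> outside the image of \<open>d\<close> this takes arbitrary
    values, which \<open>cyl\<close> never reads.\<close>
  define t where "t = (\<lambda>x\<in>E. s (inv_into {..<k} d x))"
  have "(\<lambda>i\<in>{..<k}. t (d i)) = s"
    using s d by (intro extensionalityI[of _ "{..<k}"]) (auto simp: t_def rpow_def Pi_iff PiE_iff)
  moreover have "t \<in> rpow E" by (simp add: t_def)
  ultimately show "g s = h s"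
    using fun_cong[OF gh(3), of t] by (simp add: cyl_def del: restrict_apply add: restrict_apply')
qed (use gh in \<open>auto simp: smooth_def\<close>)

text \<open>All entries of the tuple live over one finite set \<open>F\<close>, and a single
  enumeration of \<open>F\<close> presents each of them.\<close>

lemma free_obj_common_cyl:
  assumes "a \<in> tuples n (carrier (free_obj E))"
  shows "\<exists>k d g. d \<in> {..<k} \<rightarrow> E \<and> g \<in> tuples n (smooth k) \<and> a = (\<lambda>i\<in>{..<n}. cyl E k d (g i))"
proof -
  obtain F b where F: "finite F" "F \<subseteq> E" and b: "b \<in> tuples n (fin_carrier F)"
    and a: "a = (\<lambda>i\<in>{..<n}. pull F E (b i))"
    using free_obj_common[OF assms] by blast
  obtain k and d :: "nat \<Rightarrow> 'a" where d: "bij_betw d {..<k} F"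
    using F(1) ex_bij_betw_nat_finite[of F] by (auto simp: lessThan_atLeast0)
  have "\<exists>h\<in>smooth k. b i = cyl F k d h" if "i < n" for i
    using fin_carrier_enum[OF _ d, of "b i"] b that by (auto simp: tuples_def cyl_def)
  then obtain h where h: "\<And>i. i < n \<Longrightarrow> h i \<in> smooth k" "\<And>i. i < n \<Longrightarrow> b i = cyl F k d (h i)"
    by metis
  have dF: "d \<in> {..<k} \<rightarrow> F" using bij_betw_apply[OF d] by auto
  have "a = (\<lambda>i\<in>{..<n}. cyl E k d (restrict h {..<n} i))"
    unfolding a by (intro restrict_ext) (simp add: h flip: cyl_eq_pull[OF F(1) dF])
  moreover have "d \<in> {..<k} \<rightarrow> E" using dF F(2) by auto
  moreover have "restrict h {..<n} \<in> tuples n (smooth k)" using h(1) by (auto simp: tuples_def)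
  ultimately show ?thesis by blast
qed

lemma free_obj_cylE:
  assumes "h \<in> carrier (free_obj E)"
  obtains n e g where "e \<in> {..<n} \<rightarrow> E" "g \<in> smooth n" "h = cyl E n e g"
proof -
  \<comment> \<open>The element is read as a tuple of length one, with its only entry at index
    0.\<close>
  have "(\<lambda>i\<in>{..<1}. h) \<in> tuples 1 (carrier (free_obj E))"
    using assms by (auto simp: tuples_def)
  then obtain k d g where d: "d \<in> {..<k} \<rightarrow> E" and g: "g \<in> tuples 1 (smooth k)"
    and eq: "(\<lambda>i\<in>{..<1}. h) = (\<lambda>i\<in>{..<1}. cyl E k d (g i))"
    using free_obj_common_cyl by blast
  have "g 0 \<in> smooth k" using g by (auto simp: tuples_def)
  moreover have "h = cyl E k d (g 0)" using fun_cong[OF eq, of 0] by simp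
  ultimately show thesis using d that by blast
qed

section \<open>The universal property\<close>

lemma cinf_ring_interp:
  "cinf_ring A \<Longrightarrow> f \<in> smooth n \<Longrightarrow> a \<in> tuples n (carrier A) \<Longrightarrow> interp A n f a \<in> carrier A"
  by (auto simp: cinf_ring_def cinf_structure_def)

lemma cinf_ring_proj:
  "cinf_ring A \<Longrightarrow> k < n \<Longrightarrow> a \<in> tuples n (carrier A) \<Longrightarrow> interp A n (smooth_proj n k) a = a k"
  by (auto simp: cinf_ring_def)

lemma cinf_ring_comp:
  assumes "cinf_ring A" "f \<in> smooth n" "g \<in> tuples n (smooth k)" "a \<in> tuples k (carrier A)"
  shows "interp A k (smooth_comp {..<k} n f g) a = interp A n f (\<lambda>i\<in>{..<n}. interp A k (g i) a)"
  using assms smooth_comp_smooth[OF assms(2,3)] by (auto simp: cinf_ring_def)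

lemma cinf_hom_interp:
  "\<phi> \<in> cinf_hom A B \<Longrightarrow> f \<in> smooth n \<Longrightarrow> a \<in> tuples n (carrier A) \<Longrightarrow>
    \<phi> (interp A n f a) = interp B n f (\<lambda>i\<in>{..<n}. \<phi> (a i))"
  by (auto simp: cinf_hom_def)

lemma cinf_hom_carrier: "\<phi> \<in> cinf_hom A B \<Longrightarrow> x \<in> carrier A \<Longrightarrow> \<phi> x \<in> carrier B"
  by (auto simp: cinf_hom_def)

lemma cinf_hom_extensional: "\<phi> \<in> cinf_hom A B \<Longrightarrow> \<phi> \<in> extensional (carrier A)"
  by (auto simp: cinf_hom_def PiE_iff)

text \<open>Precomposing \<open>g\<close> with projections moves the presentation to the enumeration
  \<open>d\<close>; the composition and projection axioms of \<open>A\<close> show that the value in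
  \<open>A\<close> survives this change.\<close>

lemma interp_reindex:
  assumes A: "cinf_ring A" and \<alpha>: "\<alpha> \<in> E \<rightarrow> carrier A"
    and d: "bij_betw d {..<k} F" "F \<subseteq> E"
    and e: "e \<in> {..<n} \<rightarrow> F" and g: "g \<in> smooth n"
  shows "\<exists>h\<in>smooth k. cyl E k d h = cyl E n e g \<and>
    interp A k h (\<lambda>i\<in>{..<k}. \<alpha> (d i)) = interp A n g (\<lambda>i\<in>{..<n}. \<alpha> (e i))"
proof -
  \<comment> \<open>\<open>c (e i)\<close> is the position of the coordinate \<open>e i\<close> in
    the enumeration \<open>d\<close>.\<close>
  define c where "c = inv_into {..<k} d"
  have c: "c (e i) < k" "d (c (e i)) = e i" if "i < n" for i
    using that e bij_betw_inv_into_right[OF d(1)] bij_betw_apply[OF bij_betw_inv_into[OF d(1)]]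
    by (auto simp: c_def Pi_iff)
  let ?p = "\<lambda>i\<in>{..<n}. smooth_proj k (c (e i))"
  let ?h = "smooth_comp {..<k} n g ?p"
  have p: "?p \<in> tuples n (smooth k)"
    using c by (auto simp: tuples_def intro!: smooth_proj_smooth)
  have a: "(\<lambda>i\<in>{..<k}. \<alpha> (d i)) \<in> tuples k (carrier A)"
    using \<alpha> d bij_betw_apply[OF d(1)] by (auto simp: tuples_def Pi_iff subset_iff)
  have "interp A k ?h (\<lambda>i\<in>{..<k}. \<alpha> (d i)) =
      interp A n g (\<lambda>i\<in>{..<n}. interp A k (?p i) (\<lambda>i\<in>{..<k}. \<alpha> (d i)))"
    by (rule cinf_ring_comp[OF A g p a])
  also have "(\<lambda>i\<in>{..<n}. interp A k (?p i) (\<lambda>i\<in>{..<k}. \<alpha> (d i))) = (\<lambda>i\<in>{..<n}. \<alpha> (e i))"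
    using c by (intro restrict_ext) (simp add: cinf_ring_proj[OF A _ a])
  finally have "interp A k ?h (\<lambda>i\<in>{..<k}. \<alpha> (d i)) = interp A n g (\<lambda>i\<in>{..<n}. \<alpha> (e i))" .
  moreover have "cyl E k d ?h = cyl E n e g"
  proof -
    have "(\<lambda>i\<in>{..<n}. ?p i (\<lambda>i\<in>{..<k}. t (d i))) = (\<lambda>i\<in>{..<n}. t (e i))" for t :: "_ \<Rightarrow> real"
      using c by (intro restrict_ext)
        (auto simp: smooth_proj_def restrict_apply' simp del: restrict_apply)
    then show ?thesis
      by (auto simp: cyl_def smooth_comp_def restrict_apply' simp del: restrict_apply)
  qed
  ultimately show ?thesis using smooth_comp_smooth[OF g p] by blast
qed

text \<open>This is the well-definedness of the extension of \<open>\<alpha>\<close>.\<close>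

lemma interp_cyl_cong:
  assumes A: "cinf_ring A" and \<alpha>: "\<alpha> \<in> E \<rightarrow> carrier A"
    and 1: "e \<in> {..<n} \<rightarrow> E" "g \<in> smooth n" and 2: "e' \<in> {..<m} \<rightarrow> E" "g' \<in> smooth m"
    and eq: "cyl E n e g = cyl E m e' g'"
  shows "interp A n g (\<lambda>i\<in>{..<n}. \<alpha> (e i)) = interp A m g' (\<lambda>i\<in>{..<m}. \<alpha> (e' i))"
proof -
  let ?F = "e ` {..<n} \<union> e' ` {..<m}"
  have F: "?F \<subseteq> E" using 1 2 by auto
  obtain k and d :: "nat \<Rightarrow> _" where d: "bij_betw d {..<k} ?F"
    using ex_bij_betw_nat_finite[of ?F] by (auto simp: lessThan_atLeast0)
  obtain h where h: "h \<in> smooth k" "cyl E k d h = cyl E n e g"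
    "interp A k h (\<lambda>i\<in>{..<k}. \<alpha> (d i)) = interp A n g (\<lambda>i\<in>{..<n}. \<alpha> (e i))"
    using interp_reindex[OF A \<alpha> d F, of e n g] 1 by auto
  obtain h' where h': "h' \<in> smooth k" "cyl E k d h' = cyl E m e' g'"
    "interp A k h' (\<lambda>i\<in>{..<k}. \<alpha> (d i)) = interp A m g' (\<lambda>i\<in>{..<m}. \<alpha> (e' i))"
    using interp_reindex[OF A \<alpha> d F, of e' m g'] 2 by auto
  have "d \<in> {..<k} \<rightarrow> E" by (intro Pi_I subsetD[OF F] bij_betw_apply[OF d])
  \<comment> \<open>Both presentations now use the same injective \<open>d\<close>, over which the
    element determines the smooth function.\<close>
  then have "h = h'"
    using h h' eq by (intro cyl_inj[OF bij_betw_imp_inj_on[OF d]]) auto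
  then show ?thesis using h(3) h'(3) by simp
qed

lemma free_hom_exists:
  assumes A: "cinf_ring A" and \<alpha>: "\<alpha> \<in> E \<rightarrow> carrier A"
  shows "\<exists>\<phi>\<in>cinf_hom (free_obj E) A. \<forall>x\<in>E. \<phi> (free_gen E x) = \<alpha> x"
proof -
  \<comment> \<open>The description is legitimate because \<open>interp_cyl_cong\<close> makes the
    value independent of the chosen presentation.\<close>
  define \<phi> where "\<phi> = (\<lambda>h\<in>carrier (free_obj E). THE b. \<exists>n e g. e \<in> {..<n} \<rightarrow> E \<and> g \<in> smooth n \<and>
    h = cyl E n e g \<and> b = interp A n g (\<lambda>i\<in>{..<n}. \<alpha> (e i)))"
  have \<phi>: "\<phi> (cyl E n e g) = interp A n g (\<lambda>i\<in>{..<n}. \<alpha> (e i))"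
    if "e \<in> {..<n} \<rightarrow> E" "g \<in> smooth n" for n e g
  proof -
    have "(THE b. \<exists>m e' g'. e' \<in> {..<m} \<rightarrow> E \<and> g' \<in> smooth m \<and>
        cyl E n e g = cyl E m e' g' \<and> b = interp A m g' (\<lambda>i\<in>{..<m}. \<alpha> (e' i))) =
        interp A n g (\<lambda>i\<in>{..<n}. \<alpha> (e i))"
    proof (rule the_equality)
      show "\<exists>m e' g'. e' \<in> {..<m} \<rightarrow> E \<and> g' \<in> smooth m \<and> cyl E n e g = cyl E m e' g' \<and>
          interp A n g (\<lambda>i\<in>{..<n}. \<alpha> (e i)) = interp A m g' (\<lambda>i\<in>{..<m}. \<alpha> (e' i))"
        by (intro exI[of _ n] exI[of _ e] exI[of _ g]) (use that in simp)
    qed (elim exE conjE, simp only: interp_cyl_cong[OF A \<alpha> that])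
    then show ?thesis using cyl_in_carrier[OF that] by (simp add: \<phi>_def)
  qed
  have \<alpha>e: "(\<lambda>i\<in>{..<n}. \<alpha> (e i)) \<in> tuples n (carrier A)" if "e \<in> {..<n} \<rightarrow> E" for n e
    using that \<alpha> by (auto simp: tuples_def Pi_iff)
  have "\<phi> h \<in> carrier A" if "h \<in> carrier (free_obj E)" for h
    using that by (rule free_obj_cylE) (use \<phi> \<alpha>e cinf_ring_interp[OF A] in simp)
  moreover have "\<phi> (interp (free_obj E) n f a) = interp A n f (\<lambda>i\<in>{..<n}. \<phi> (a i))"
    if f: "f \<in> smooth n" and a: "a \<in> tuples n (carrier (free_obj E))" for n f a
  proof -
    obtain k d g where d: "d \<in> {..<k} \<rightarrow> E" and g: "g \<in> tuples n (smooth k)"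
      and a: "a = (\<lambda>i\<in>{..<n}. cyl E k d (g i))"
      using free_obj_common_cyl[OF a] by blast
    have "\<phi> (interp (free_obj E) n f a) = interp A k (smooth_comp {..<k} n f g) (\<lambda>i\<in>{..<k}. \<alpha> (d i))"
      unfolding a interp_cyl by (rule \<phi>[OF d smooth_comp_smooth[OF f g]])
    \<comment> \<open>The composition axiom in \<open>A\<close> mirrors the composition of smooth
      functions in the free object.\<close>
    also have "\<dots> = interp A n f (\<lambda>i\<in>{..<n}. interp A k (g i) (\<lambda>i\<in>{..<k}. \<alpha> (d i)))"
      by (rule cinf_ring_comp[OF A f g \<alpha>e[OF d]])
    also have "(\<lambda>i\<in>{..<n}. interp A k (g i) (\<lambda>i\<in>{..<k}. \<alpha> (d i))) = (\<lambda>i\<in>{..<n}. \<phi> (a i))"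
      using g by (intro restrict_ext) (auto simp: a \<phi>[OF d] tuples_def PiE_iff)
    finally show ?thesis .
  qed
  moreover have "\<phi> \<in> extensional (carrier (free_obj E))" by (simp add: \<phi>_def)
  moreover have "\<phi> (free_gen E x) = \<alpha> x" if x: "x \<in> E" for x
  proof -
    have "\<phi> (free_gen E x) = interp A 1 (smooth_proj 1 0) (\<lambda>i\<in>{..<1}. \<alpha> x)"
      unfolding free_gen_cyl[OF x] using x by (intro \<phi> smooth_proj_smooth) auto
    also have "\<dots> = \<alpha> x"
      using \<alpha>e[of "\<lambda>_. x" 1] x by (subst cinf_ring_proj[OF A]) auto
    finally show ?thesis .
  qed
  ultimately show ?thesis
    by (intro bexI[of _ \<phi>]) (auto simp: cinf_hom_def PiE_iff)
qed

text \<open>Each element is an operation applied to generators by \<open>cyl_eq_interp\<close>, and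
  both homomorphisms commute with that operation.\<close>

lemma free_hom_unique:
  assumes \<phi>: "\<phi> \<in> cinf_hom (free_obj E) A" and \<psi>: "\<psi> \<in> cinf_hom (free_obj E) A"
    and eq: "\<And>x. x \<in> E \<Longrightarrow> \<phi> (free_gen E x) = \<psi> (free_gen E x)"
  shows "\<phi> = \<psi>"
proof (rule extensionalityI[OF cinf_hom_extensional[OF \<phi>] cinf_hom_extensional[OF \<psi>]])
  fix h assume "h \<in> carrier (free_obj E)"
  then show "\<phi> h = \<psi> h"
  proof (rule free_obj_cylE)
    fix n e g assume e: "e \<in> {..<n} \<rightarrow> E" and g: "g \<in> smooth n" and h: "h = cyl E n e g"
    let ?a = "\<lambda>i\<in>{..<n}. free_gen E (e i)"
    have a: "?a \<in> tuples n (carrier (free_obj E))"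
      using e by (auto simp: tuples_def intro!: free_gen_in_carrier)
    have "(\<lambda>i\<in>{..<n}. \<phi> (?a i)) = (\<lambda>i\<in>{..<n}. \<psi> (?a i))"
      using e eq by (intro restrict_ext) auto
    then show "\<phi> h = \<psi> h"
      unfolding h cyl_eq_interp[OF e] cinf_hom_interp[OF \<phi> g a] cinf_hom_interp[OF \<psi> g a] by simp
  qed
qed

section \<open>The adjunction\<close>

lemma cinf_hom_id: "cinf_ring A \<Longrightarrow> (\<lambda>x\<in>carrier A. x) \<in> cinf_hom A A"
proof -
  assume A: "cinf_ring A"
  have "(\<lambda>i\<in>{..<n}. (\<lambda>x\<in>carrier A. x) (a i)) = a" if "a \<in> tuples n (carrier A)" for n a
    using that by (intro extensionalityI[of _ "{..<n}"]) (auto simp: tuples_def PiE_iff)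
  then show ?thesis
    using cinf_ring_interp[OF A] by (auto simp: cinf_hom_def)
qed

lemma cinf_hom_compose:
  assumes A: "cinf_ring A" and \<phi>: "\<phi> \<in> cinf_hom A B" and \<psi>: "\<psi> \<in> cinf_hom B C"
  shows "compose (carrier A) \<psi> \<phi> \<in> cinf_hom A C"
proof -
  have "\<psi> (\<phi> (interp A n f a)) = interp C n f (\<lambda>i\<in>{..<n}. compose (carrier A) \<psi> \<phi> (a i))"
    if f: "f \<in> smooth n" and a: "a \<in> tuples n (carrier A)" for n f a
  proof -
    have "(\<lambda>i\<in>{..<n}. \<phi> (a i)) \<in> tuples n (carrier B)"
      using a cinf_hom_carrier[OF \<phi>] by (auto simp: tuples_def)
    then have "\<psi> (\<phi> (interp A n f a)) = interp C n f (\<lambda>i\<in>{..<n}. \<psi> ((\<lambda>i\<in>{..<n}. \<phi> (a i)) i))"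
      using cinf_hom_interp[OF \<phi> f a] cinf_hom_interp[OF \<psi> f] by simp
    also have "(\<lambda>i\<in>{..<n}. \<psi> ((\<lambda>i\<in>{..<n}. \<phi> (a i)) i)) = (\<lambda>i\<in>{..<n}. compose (carrier A) \<psi> \<phi> (a i))"
      using a by (intro restrict_ext) (auto simp: compose_def tuples_def)
    finally show ?thesis .
  qed
  moreover have "compose (carrier A) \<psi> \<phi> \<in> carrier A \<rightarrow>\<^sub>E carrier C"
    using cinf_hom_carrier[OF \<phi>] cinf_hom_carrier[OF \<psi>] by (auto simp: compose_def)
  ultimately show ?thesis
    \<comment> \<open>Closure of the carrier of \<open>A\<close> lets the restricted composite be
      evaluated at \<open>interp A n f a\<close>.\<close>
    using cinf_ring_interp[OF A] by (auto simp: cinf_hom_def compose_eq)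
qed

section \<open>The bijection of hom-sets\<close>

lemma adj_map_apply: "x \<in> X \<Longrightarrow> adj_map X \<phi> x = \<phi> (free_gen X x)"
  by (simp add: adj_map_def forget_map_def compose_eq)

text \<open>Injectivity is the uniqueness half of the universal property, surjectivity the existence
  half.\<close>

lemma bij_betw_adj_map:
  assumes A: "cinf_ring A"
  shows "bij_betw (adj_map X) (cinf_hom (free_obj X) A) (X \<rightarrow>\<^sub>E forget_obj A)"
proof (rule bij_betw_imageI)
  show "inj_on (adj_map X) (cinf_hom (free_obj X) A)"
    by (rule inj_onI, rule free_hom_unique) (auto simp flip: adj_map_apply)
  have "adj_map X \<phi> \<in> X \<rightarrow>\<^sub>E forget_obj A" if "\<phi> \<in> cinf_hom (free_obj X) A" for \<phi>
    by (auto simp: adj_map_def forget_map_def forget_obj_def compose_def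
        intro!: cinf_hom_carrier[OF that] free_gen_in_carrier)
  moreover have "\<alpha> \<in> adj_map X ` cinf_hom (free_obj X) A" if \<alpha>: "\<alpha> \<in> X \<rightarrow>\<^sub>E forget_obj A" for \<alpha>
  proof -
    obtain \<phi> where \<phi>: "\<phi> \<in> cinf_hom (free_obj X) A" "\<forall>x\<in>X. \<phi> (free_gen X x) = \<alpha> x"
      using free_hom_exists[OF A, of \<alpha> X] \<alpha> by (auto simp: forget_obj_def PiE_iff)
    have "\<alpha> = adj_map X \<phi>"
      using \<alpha> \<phi>(2)
      by (intro extensionalityI[of _ X])
        (auto simp: adj_map_apply PiE_iff, simp add: adj_map_def)
    then show ?thesis using \<phi>(1) by blast
  qed
  ultimately show "adj_map X ` cinf_hom (free_obj X) A = X \<rightarrow>\<^sub>E forget_obj A" by blast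
qed

text \<open>The hom-set bijection is applied with \<open>free_obj Y\<close> as target; this
  justifies the definite description in \<open>free_map\<close>.\<close>

lemma free_map_ex1:
  assumes "f \<in> X \<rightarrow> Y"
  shows "\<exists>!\<phi>. \<phi> \<in> cinf_hom (free_obj X) (free_obj Y) \<and>
    compose X (forget_map \<phi>) (free_gen X) = compose X (free_gen Y) f"
proof -
  have bij: "bij_betw (adj_map X) (cinf_hom (free_obj X) (free_obj Y)) (X \<rightarrow>\<^sub>E forget_obj (free_obj Y))"
    by (rule bij_betw_adj_map[OF cinf_ring_free_obj])
  have "compose X (free_gen Y) f \<in> X \<rightarrow>\<^sub>E forget_obj (free_obj Y)"
    using assms by (auto simp: forget_obj_def compose_def intro!: free_gen_in_carrier)
  then have "compose X (free_gen Y) f \<in> adj_map X ` cinf_hom (free_obj X) (free_obj Y)"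
    by (simp only: bij_betw_imp_surj_on[OF bij])
  then obtain \<phi> where \<phi>: "\<phi> \<in> cinf_hom (free_obj X) (free_obj Y)"
    "compose X (free_gen Y) f = adj_map X \<phi>"
    by (rule imageE)
  have "\<psi> = \<phi>" if "\<psi> \<in> cinf_hom (free_obj X) (free_obj Y)" "adj_map X \<psi> = adj_map X \<phi>" for \<psi>
    using inj_onD[OF bij_betw_imp_inj_on[OF bij] that(2,1) \<phi>(1)] .
  then show ?thesis
    unfolding adj_map_def[symmetric] \<phi>(2) using \<phi>(1) by blast
qed

section \<open>Functoriality and naturality\<close>

lemma free_map:
  assumes "f \<in> X \<rightarrow> Y"
  shows "free_map X Y f \<in> cinf_hom (free_obj X) (free_obj Y)"
    and "compose X (forget_map (free_map X Y f)) (free_gen X) = compose X (free_gen Y) f"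
  using theI'[OF free_map_ex1[OF assms]] by (simp_all add: free_map_def)

lemma free_map_gen:
  assumes "f \<in> X \<rightarrow> Y" "x \<in> X"
  shows "free_map X Y f (free_gen X x) = free_gen Y (f x)"
  using fun_cong[OF free_map(2)[OF assms(1)], of x] assms(2) by (simp add: compose_def forget_map_def)

lemma free_map_id: "free_map X X (\<lambda>x\<in>X. x) = (\<lambda>h\<in>carrier (free_obj X). h)"
  by (rule free_hom_unique[OF free_map(1) cinf_hom_id[OF cinf_ring_free_obj]])
    (auto simp: free_map_gen free_gen_in_carrier)

text \<open>Both sides are homomorphisms sending \<open>free_gen X x\<close> to
  \<open>free_gen Z (g (f x))\<close>, hence they agree.\<close>

lemma free_map_compose:
  assumes f: "f \<in> X \<rightarrow> Y" and g: "g \<in> Y \<rightarrow> Z"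
  shows "free_map X Z (compose X g f) = compose (carrier (free_obj X)) (free_map Y Z g) (free_map X Y f)"
proof -
  have gf: "compose X g f \<in> X \<rightarrow> Z" using f g by (auto simp: compose_def)
  show ?thesis
  proof (rule free_hom_unique[OF free_map(1)[OF gf]])
    show "compose (carrier (free_obj X)) (free_map Y Z g) (free_map X Y f) \<in> cinf_hom (free_obj X) (free_obj Z)"
      by (rule cinf_hom_compose[OF cinf_ring_free_obj free_map(1)[OF f] free_map(1)[OF g]])
    fix x assume x: "x \<in> X"
    then have "f x \<in> Y" using f by auto
    then show "free_map X Z (compose X g f) (free_gen X x) =
        compose (carrier (free_obj X)) (free_map Y Z g) (free_map X Y f) (free_gen X x)"
      using x free_map_gen[OF gf x] free_map_gen[OF f x] free_map_gen[OF g]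
      by (simp add: compose_eq free_gen_in_carrier)
  qed
qed

text \<open>At \<open>x\<close> both sides equal \<open>\<psi> (\<phi> (free_gen Y (f x)))\<close>.
  The single equation treats the set argument through \<open>f\<close> and the ring argument through
  \<open>\<psi>\<close>.\<close>

lemma adj_map_natural:
  assumes f: "f \<in> X \<rightarrow> Y"
  shows "adj_map X
      (compose (carrier (free_obj X)) \<psi> (compose (carrier (free_obj X)) \<phi> (free_map X Y f))) =
    compose X (forget_map \<psi>) (compose X (adj_map Y \<phi>) f)"
proof (rule extensionalityI[of _ X])
  fix x assume x: "x \<in> X"
  then have "f x \<in> Y" using f by auto
  then show "adj_map X
      (compose (carrier (free_obj X)) \<psi> (compose (carrier (free_obj X)) \<phi> (free_map X Y f))) x =
    compose X (forget_map \<psi>) (compose X (adj_map Y \<phi>) f) x"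
    using x f by (simp add: adj_map_apply compose_eq free_gen_in_carrier free_map_gen forget_map_def)
qed (simp_all add: adj_map_def)

theorem proposition11:
  shows
    \<comment> \<open>\<open>L\<close> is well defined on objects and on morphisms\<close>
    "(\<forall>X::'x set. cinf_ring (free_obj X)) \<and>
     (\<forall>(X::'x set) (Y::'y set). \<forall>f\<in>X \<rightarrow>\<^sub>E Y.
        (\<exists>!\<phi>. \<phi> \<in> cinf_hom (free_obj X) (free_obj Y) \<and>
              compose X (forget_map \<phi>) (free_gen X) = compose X (free_gen Y) f) \<and>
        free_map X Y f \<in> cinf_hom (free_obj X) (free_obj Y) \<and>
        compose X (forget_map (free_map X Y f)) (free_gen X) = compose X (free_gen Y) f) \<and>
     \<comment> \<open>\<open>L\<close> is a functor\<close>
     (\<forall>X::'x set. free_map X X (\<lambda>x\<in>X. x) = (\<lambda>h\<in>carrier (free_obj X). h)) \<and>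
     (\<forall>(X::'x set) (Y::'y set) (Z::'z set). \<forall>f\<in>X \<rightarrow>\<^sub>E Y. \<forall>g\<in>Y \<rightarrow>\<^sub>E Z.
        free_map X Z (compose X g f) =
        compose (carrier (free_obj X)) (free_map Y Z g) (free_map X Y f)) \<and>
     \<comment> \<open>\<open>L\<close> is left adjoint to \<open>U\<close>: a bijection of hom-sets, natural in both arguments\<close>
     (\<forall>(X::'x set) (A::'a cinf_struct). cinf_ring A \<longrightarrow>
        bij_betw (adj_map X) (cinf_hom (free_obj X) A) (X \<rightarrow>\<^sub>E forget_obj A)) \<and>
     (\<forall>(X::'x set) (Y::'y set) (A::'a cinf_struct) (B::'b cinf_struct).
        cinf_ring A \<longrightarrow> cinf_ring B \<longrightarrow>
        (\<forall>f\<in>X \<rightarrow>\<^sub>E Y. \<forall>\<phi>\<in>cinf_hom (free_obj Y) A. \<forall>\<psi>\<in>cinf_hom A B.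
           adj_map X
             (compose (carrier (free_obj X)) \<psi> (compose (carrier (free_obj X)) \<phi> (free_map X Y f))) =
           compose X (forget_map \<psi>) (compose X (adj_map Y \<phi>) f)))"
proof (intro conjI allI impI ballI)
  fix X :: "'x set" and Y :: "'y set" and f assume "f \<in> X \<rightarrow>\<^sub>E Y"
  then have f: "f \<in> X \<rightarrow> Y" by auto
  show "\<exists>!\<phi>. \<phi> \<in> cinf_hom (free_obj X) (free_obj Y) \<and>
      compose X (forget_map \<phi>) (free_gen X) = compose X (free_gen Y) f"
    by (rule free_map_ex1[OF f])
  show "free_map X Y f \<in> cinf_hom (free_obj X) (free_obj Y)"
    "compose X (forget_map (free_map X Y f)) (free_gen X) = compose X (free_gen Y) f"
    by (rule free_map[OF f])+
qed (rule cinf_ring_free_obj free_map_id free_map_compose bij_betw_adj_map adj_map_natural;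
    auto simp: PiE_iff)+

end
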